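(* For every even positive integer $n$, $$C_{\mathbb{C},n}=2^{\frac{n+2}{8}}\cdot\frac{\sqrt{2}}{\sqrt{\pi}}\cdot r_{n}.$$
   Context: For $p>0$ put $A_p=\sqrt{2}\left(\frac{\Gamma((p+1)/2)}{\sqrt{\pi}}\right)^{1/p}$, where $\Gamma$ is the Gamma function. The real numbers $C_{\mathbb{C},n}$, $n\ge 2$ (estimates for the constants in the complex Bohnenblust--Hille inequality), are defined recursively by $C_{\mathbb{C},2}=\frac{2}{\sqrt{\pi}}$, $C_{\mathbb{C},3}=\left(\frac{2}{\sqrt{\pi}}\right)^{2}$, and $$C_{\mathbb{C},n}=\frac{2^{\frac{n+2}{2n}}}{\pi^{1/n}}\left(\frac{1}{A_{\frac{2n-4}{n-1}}^{2}}\right)^{\frac{n-2}{n}}\left(C_{\mathbb{C},n-2}\right)^{\frac{n-2}{n}}\quad\text{for } n\ge 4.$$ For even positive integers $n$ define $$r_n=\frac{1}{2^{\frac{n-2}{4}}\left[\prod_{k=1}^{\frac{n-2}{2}}\left(\frac{\Gamma\left(\frac{6k+1}{4k+2}\right)}{\sqrt{\pi}}\right)^{2k+1}\right]^{1/n}}$$ (an empty product equals $1$). *)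

theory Defs
  imports "HOL-Analysis.Analysis"
begin

definition A_const :: "real \<Rightarrow> real" where
  "A_const p = sqrt 2 * (Gamma ((p + 1) / 2) / sqrt pi) powr (1 / p)"

(* The constants are only meaningful for n \<ge> 2; the values at 0 and 1 are left unspecified. *)
fun C_complex :: "nat \<Rightarrow> real" where
  "C_complex n =
    (if n = 2 then 2 / sqrt pi
     else if n = 3 then (2 / sqrt pi)\<^sup>2
     else if n \<ge> 4 then
       2 powr ((real n + 2) / (2 * real n)) / pi powr (1 / real n)
       * (1 / (A_const ((2 * real n - 4) / (real n - 1)))\<^sup>2) powr ((real n - 2) / real n)
       * C_complex (n - 2) powr ((real n - 2) / real n)
     else undefined)"

(* The unconditional defining equation would make the simplifier loop. *)
declare C_complex.simps [simp del]

(* Intended for even positive n, where (n - 2) div 2 is exact and does not truncate. *)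
definition r_even :: "nat \<Rightarrow> real" where
  "r_even n =
    1 / (2 powr ((real n - 2) / 4)
         * (\<Prod>k = 1..(n - 2) div 2.
              (Gamma ((6 * real k + 1) / (4 * real k + 2)) / sqrt pi) ^ (2 * k + 1))
           powr (1 / real n))"

end

theory Submission
  imports Defs
begin

text \<open>Writing \<open>n = 2 m + 2\<close>, all factors are positive, so the recursion and the closed form can be
  compared after taking logarithms. The closed form collects the powers of \<open>2\<close> in \<open>r_even\<close> and in
  the prefactor into the single exponent \<open>(10 - n) / 8 = (4 - m) / 4\<close>.\<close>

definition gamma_factor :: "nat \<Rightarrow> real" where
  "gamma_factor k = Gamma ((6 * real k + 1) / (4 * real k + 2)) / sqrt pi"

lemma gamma_factor_pos: "gamma_factor k > 0"
  unfolding gamma_factor_def by (intro divide_pos_pos Gamma_real_pos) auto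

lemma prod_gamma_factor_pos: "(\<Prod>k = 1..m. gamma_factor k ^ (2 * k + 1)) > 0"
  by (intro prod_pos zero_less_power ballI gamma_factor_pos)

text \<open>For \<open>n = 2 * m + 4\<close> the parameter (2n-4)/(n-1) becomes (4m+4)/(2m+3), and
  adding 1 and halving gives (6m+7)/(4m+6). So each recursion step brings in exactly the Gamma
  factor of the new index \<open>k = Suc m\<close>.\<close>

lemma A_const_even:
  "A_const ((4 * real m + 4) / (2 * real m + 3)) =
     sqrt 2 * gamma_factor (Suc m) powr ((2 * real m + 3) / (4 * real m + 4))"
proof -
  have "((4 * real m + 4) / (2 * real m + 3) + 1) / 2
      = (6 * real (Suc m) + 1) / (4 * real (Suc m) + 2)"
    by (simp add: field_simps)
  moreover have "1 / ((4 * real m + 4) / (2 * real m + 3)) = (2 * real m + 3) / (4 * real m + 4)"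
    by simp
  ultimately show ?thesis
    unfolding A_const_def gamma_factor_def by (simp only:)
qed

lemma C_complex_even_rec:
  "C_complex (2 * Suc m + 2) =
     2 powr ((real m + 3) / (2 * real m + 4)) / pi powr (1 / (2 * real m + 4))
     * (1 / (A_const ((4 * real m + 4) / (2 * real m + 3)))\<^sup>2) powr ((real m + 1) / (real m + 2))
     * C_complex (2 * m + 2) powr ((real m + 1) / (real m + 2))"
proof -
  have e1: "(real (2 * Suc m + 2) + 2) / (2 * real (2 * Suc m + 2)) = (real m + 3) / (2 * real m + 4)"
    and e2: "1 / real (2 * Suc m + 2) = 1 / (2 * real m + 4)"
    and e3: "(2 * real (2 * Suc m + 2) - 4) / (real (2 * Suc m + 2) - 1)
       = (4 * real m + 4) / (2 * real m + 3)"
    and e4: "(real (2 * Suc m + 2) - 2) / real (2 * Suc m + 2) = (real m + 1) / (real m + 2)"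
    by (simp_all add: field_simps)
  have "2 * Suc m + 2 \<noteq> 2" "2 * Suc m + 2 \<noteq> 3" "2 * Suc m + 2 \<ge> 4" "2 * Suc m + 2 - 2 = 2 * m + 2"
    by presburger+
  then show ?thesis
    by (subst C_complex.simps) (simp only: e1 e2 e3 e4 if_True if_False)
qed

text \<open>Raising to the power (m+1)/(m+2) turns the root exponent 1/(2m+2) of the old product
  into 1/(2m+4). The same power turns the exponent (2m+3)/(2m+2) of the new Gamma factor into
  (2m+3)/(2m+4), which is what appending that factor with multiplicity 2m+3 requires.\<close>

lemma C_complex_even:
  "C_complex (2 * m + 2) =
     2 powr ((4 - real m) / 4) / sqrt pi
     / (\<Prod>k = 1..m. gamma_factor k ^ (2 * k + 1)) powr (1 / (2 * real m + 2))"
proof (induction m)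
  case 0
  show ?case by (simp add: C_complex.simps)
next
  case (Suc m)
  define P where "P = (\<Prod>k = 1..m. gamma_factor k ^ (2 * k + 1))"
  define g where "g = gamma_factor (Suc m)"
  have P: "P > 0" and g: "g > 0"
    unfolding P_def g_def by (rule prod_gamma_factor_pos gamma_factor_pos)+
  have P': "(\<Prod>k = 1..Suc m. gamma_factor k ^ (2 * k + 1)) = P * g ^ (2 * m + 3)"
    by (simp add: P_def g_def numeral_3_eq_3)
  \<comment> \<open>\<open>?l\<close> is the right side of the recursion after inserting
    \<open>A_const_even\<close> and the induction hypothesis; \<open>?r\<close> is the closed form
    at \<open>Suc m\<close>.\<close>
  let ?l = "2 powr ((real m + 3) / (2 * real m + 4)) / pi powr (1 / (2 * real m + 4))
     * (1 / (sqrt 2 * g powr ((2 * real m + 3) / (4 * real m + 4)))\<^sup>2) powr ((real m + 1) / (real m + 2))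
     * (2 powr ((4 - real m) / 4) / sqrt pi / P powr (1 / (2 * real m + 2)))
         powr ((real m + 1) / (real m + 2))"
  let ?r = "2 powr ((4 - real (Suc m)) / 4) / sqrt pi
     / (P * g ^ (2 * m + 3)) powr (1 / (2 * real (Suc m) + 2))"
  have "(2 * real m + 3) / (4 * real m + 4) * 2 = (2 * real m + 3) / (2 * real m + 2)"
    by (simp add: field_simps)
  then have sq: "(sqrt 2 * g powr ((2 * real m + 3) / (4 * real m + 4)))\<^sup>2
      = 2 * g powr ((2 * real m + 3) / (2 * real m + 2))"
    using g by (simp add: power_mult_distrib powr_power mult.commute)
  have "ln ?l = (real m + 3) / (2 * real m + 4) * ln 2 - ln pi / (2 * real m + 4)
     - (real m + 1) / (real m + 2) * (ln 2 + (2 * real m + 3) / (2 * real m + 2) * ln g)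
     + (real m + 1) / (real m + 2)
        * ((4 - real m) / 4 * ln 2 - ln pi / 2 - ln P / (2 * real m + 2))"
    unfolding sq using P g
    by (simp add: ln_mult ln_div ln_powr ln_sqrt ln_realpow)
      (simp add: algebra_simps diff_divide_distrib add_divide_distrib)
  \<comment> \<open>Compare coefficients. For \<open>ln 2\<close>, the common denominator 4(m+2)
    leaves the numerator 6 + m - m^2 = (3-m)(m+2). For \<open>ln pi\<close>, 1/(2m+4) + (m+1)/(2m+4)
    = 1/2.\<close>
  also have "\<dots> = (3 - real m) / 4 * ln 2 - ln pi / 2
      - (ln P + (2 * real m + 3) * ln g) / (2 * real m + 4)"
    by (simp add: divide_simps) (simp add: algebra_simps)
  also have "\<dots> = ln ?r"
    using P g by (simp add: ln_mult ln_div ln_powr ln_sqrt ln_realpow)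
  finally have "ln ?l = ln ?r" .
  \<comment> \<open>Positivity is what allows passing from equal logarithms back to equal
    numbers.\<close>
  moreover have "?l > 0" "?r > 0" using P g by simp_all
  ultimately have "?l = ?r" by (simp only: ln_inj_iff)
  then show ?case
    by (simp only: C_complex_even_rec A_const_even Suc.IH P' flip: P_def g_def)
qed

theorem theorem3p2:
  fixes n :: nat
  assumes "even n" and "n > 0"
  shows "C_complex n = 2 powr ((real n + 2) / 8) * (sqrt 2 / sqrt pi) * r_even n"
proof -
  obtain m where n: "n = 2 * m + 2"
    using assms by (metis evenE gr0_implies_Suc mult_Suc_right add.commute nat_0_less_mult_iff)
  \<comment> \<open>The summand 1/2 comes from the factor \<open>sqrt 2\<close>, and the subtracted
    term from the power of 2 in the denominator of \<open>r_even\<close>.\<close>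
  have "(real n + 2) / 8 + 1 / 2 - (real n - 2) / 4 = (4 - real m) / 4"
    by (simp add: n field_simps)
  then have two: "2 powr ((real n + 2) / 8) * sqrt 2 / 2 powr ((real n - 2) / 4)
      = 2 powr ((4 - real m) / 4)"
    by (simp only: powr_half_sqrt[symmetric] zero_le_numeral flip: powr_add powr_diff)
  have half: "(n - 2) div 2 = m" and size: "2 * real m + 2 = real n"
    by (simp_all add: n)
  have "2 powr ((real n + 2) / 8) * (sqrt 2 / sqrt pi) * r_even n
      = 2 powr ((real n + 2) / 8) * sqrt 2 / 2 powr ((real n - 2) / 4) / sqrt pi
        / (\<Prod>k = 1..m. gamma_factor k ^ (2 * k + 1)) powr (1 / real n)"
    unfolding r_even_def gamma_factor_def half by simp
  also have "\<dots> = C_complex n"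
    unfolding two using C_complex_even[of m] by (simp only: size flip: n)
  finally show ?thesis by simp
qed

end
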